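(* Let $R$ be a finite chain ring of Loewy length $n$, and define the power series $$G_R(x)=\sum_{k=0}^{\infty}\zeta_k(R)x^k .$$ Then $$G_R(x)=\frac{1}{1-x}-\sum_{t=0}^{n-1}[y^t]\,\frac{1}{1-\dfrac{x}{n+1}\left(1+y+\cdots+y^n\right)},$$ where $[y^t]$ denotes extraction of the coefficient of $y^t$.
   Context: A finite chain ring $(R,M)$ is a finite (nonzero) commutative ring with identity whose ideals are linearly ordered by inclusion; $M$ denotes its unique maximal ideal. Its Loewy length is the smallest positive integer $n$ with $M^n=(0)$. For a finite commutative ring $R$, let $\mathcal I(R)$ denote the set of all ideals of $R$. For an integer $k\ge 2$, the ideal zero-product probability is $$\zeta_k(R)=\frac{|\{(I_1,\ldots,I_k)\in\mathcal I(R)^k : I_1I_2\cdots I_k=(0)\}|}{|\mathcal I(R)|^k},$$ where $I_1\cdots I_k$ is the usual product of ideals. By convention $\zeta_0(R)=0$ and $\zeta_1(R)=1/|\mathcal I(R)|$. The identities are identities of formal power series; $\frac{1}{1-\frac{x}{n+1}(1+y+\cdots+y^n)}$ is expanded as a geometric series in $x$. *)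

theory Defs
  imports
    "HOL-Algebra.Algebra"
    "HOL-Computational_Algebra.Formal_Power_Series"
begin

locale finite_chain_ring = cring R for R (structure) +
  fixes M :: "'a set"
  assumes finite_carrier: "finite (carrier R)"
    and one_not_zero: "\<one> \<noteq> \<zero>"
    and ideals_linear: "\<lbrakk>ideal I R; ideal J R\<rbrakk> \<Longrightarrow> I \<subseteq> J \<or> J \<subseteq> I"
    and unique_maximal: "{N. maximalideal N R} = {M}"

text \<open>
  The monoid \<open>ideals_set R\<close> consists of the ideals of \<open>R\<close> under the product of ideals, with unit
  \<open>carrier R\<close>. Its powers and finite products are thus the usual powers and products of ideals.
\<close>

definition loewy_length :: "('a, 'b) ring_scheme \<Rightarrow> 'a set \<Rightarrow> nat" where
  "loewy_length R M = (LEAST n. n > 0 \<and> M [^]\<^bsub>ideals_set R\<^esub> n = {\<zero>\<^bsub>R\<^esub>})"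

definition zero_product_tuples :: "('a, 'b) ring_scheme \<Rightarrow> nat \<Rightarrow> (nat \<Rightarrow> 'a set) set" where
  "zero_product_tuples R k =
     {I \<in> {1..k} \<rightarrow>\<^sub>E {J. ideal J R}. (\<Otimes>\<^bsub>ideals_set R\<^esub> i\<in>{1..k}. I i) = {\<zero>\<^bsub>R\<^esub>}}"

text \<open>The values for \<open>k = 0\<close> and \<open>k = 1\<close> are conventions.\<close>

definition ideal_zero_prob :: "('a, 'b) ring_scheme \<Rightarrow> nat \<Rightarrow> real" where
  "ideal_zero_prob R k =
     (if k = 0 then 0
      else if k = 1 then 1 / real (card {J. ideal J R})
      else real (card (zero_product_tuples R k)) / real (card {J. ideal J R}) ^ k)"

definition ideal_zero_gf :: "('a, 'b) ring_scheme \<Rightarrow> real fps" where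
  "ideal_zero_gf R = Abs_fps (ideal_zero_prob R)"

text \<open>
  Bivariate series are elements of \<open>real fps fps\<close>: the outer variable is \<open>x\<close>, and the coefficients
  are series in \<open>y\<close>. So \<open>x\<close> is the outer \<open>fps_X\<close>, and \<open>y\<close> is \<open>fps_const fps_X\<close>.
\<close>

definition coeff_y :: "nat \<Rightarrow> real fps fps \<Rightarrow> real fps" where
  "coeff_y t F = Abs_fps (\<lambda>k. fps_nth (fps_nth F k) t)"

definition chain_kernel :: "nat \<Rightarrow> real fps fps" where
  "chain_kernel n =
     1 / (1 - fps_const (fps_const (1 / (real n + 1))) * fps_X * (\<Sum>i\<le>n. fps_const fps_X ^ i))"

text \<open>The quotient is the geometric series in \<open>x\<close>, as the following check confirms.\<close>

lemma chain_kernel_nth: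
  "fps_nth (chain_kernel n) k = (fps_const (1 / (real n + 1)) * (\<Sum>i\<le>n. fps_X ^ i)) ^ k"
proof -
  define c :: "real fps" where "c = fps_const (1 / (real n + 1)) * (\<Sum>i\<le>n. fps_X ^ i)"
  define D :: "real fps fps" where "D = 1 - fps_const c * fps_X"
  have "(\<Sum>i\<le>n. fps_const fps_X ^ i) = fps_const (\<Sum>i\<le>n. (fps_X :: real fps) ^ i)"
    by (rule fps_ext) (simp add: fps_sum_nth fps_const_power)
  hence "fps_const (fps_const (1 / (real n + 1))) * fps_X * (\<Sum>i\<le>n. fps_const fps_X ^ i)
      = fps_const c * fps_X"
    by (simp add: c_def mult_ac del: fps_const_power flip: fps_const_mult)
  hence kernel: "chain_kernel n = 1 / D"
    unfolding chain_kernel_def D_def by (rule arg_cong)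
  have D0: "fps_nth D 0 = 1"
    by (simp add: D_def)
  hence "subdegree D = 0"
    by (simp add: subdegree_eq_0_iff)
  hence inv: "chain_kernel n = inverse D"
    by (simp add: kernel fps_divide_unit')
  have "D * Abs_fps (\<lambda>k. c ^ k) = 1"
  proof (rule fps_ext)
    fix m
    have "D * Abs_fps (\<lambda>k. c ^ k)
        = Abs_fps (\<lambda>k. c ^ k) - fps_const c * (fps_X * Abs_fps (\<lambda>k. c ^ k))"
      by (simp add: D_def algebra_simps)
    thus "fps_nth (D * Abs_fps (\<lambda>k. c ^ k)) m = fps_nth 1 m"
      by (cases m) simp_all
  qed
  hence "inverse D * D * Abs_fps (\<lambda>k. c ^ k) = inverse D"
    by (simp add: mult.assoc)
  moreover have "inverse D * D = 1"
    using fps_left_inverse'[of 1 D 1] by (simp add: fps_inverse_def[of D] D0)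
  ultimately have "chain_kernel n = Abs_fps (\<lambda>k. c ^ k)"
    by (simp add: inv)
  thus ?thesis
    by (simp add: c_def)
qed

end

theory Submission
  imports Defs
begin

text \<open>
  A finite chain ring has a principal maximal ideal \<open>M\<close>, and its ideals are exactly the distinct
  powers \<open>M\<^sup>0, \<dots>, M\<^sup>n\<close>. A product of powers of \<open>M\<close> vanishes iff the exponents add up to at least
  \<open>n\<close>, so among the \<open>(n + 1)\<^sup>k\<close> tuples of ideals those with non-zero product are the exponent tuples
  in \<open>{0..n}\<^sup>k\<close> with sum \<open>t < n\<close>, and there are \<open>[y\<^sup>t] (1 + y + \<dots> + y\<^sup>n)\<^sup>k\<close> of them for each \<open>t\<close>.
\<close>

section \<open>Counting exponent tuples by their sum\<close>

lemma fps_nth_geometric_power: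
  "fps_nth ((\<Sum>i\<le>n. fps_X ^ i) ^ k :: 'a::comm_ring_1 fps) t =
     of_nat (card {a \<in> {1..k} \<rightarrow>\<^sub>E {..n}. (\<Sum>i=1..k. a i) = t})"
proof -
  let ?A = "{1..k} \<rightarrow>\<^sub>E {..n}"
  have fin: "finite ?A" by (simp add: finite_PiE)
  \<comment> \<open>As a product of \<open>k\<close> equal sums, the power expands by distributivity
    into one monomial for each choice function \<open>a\<close>.\<close>
  have "(\<Sum>i\<le>n. fps_X ^ i) ^ k = (\<Prod>j\<in>{1..k}. \<Sum>i\<le>n. (fps_X :: 'a fps) ^ i)"
    by simp
  also have "\<dots> = (\<Sum>a\<in>?A. \<Prod>j\<in>{1..k}. fps_X ^ a j)"
    by (rule prod_sum_PiE) auto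
  also have "\<dots> = (\<Sum>a\<in>?A. fps_X ^ (\<Sum>i=1..k. a i))"
    by (simp add: power_sum)
  finally have "fps_nth ((\<Sum>i\<le>n. fps_X ^ i) ^ k :: 'a fps) t =
      (\<Sum>a\<in>?A. if (\<Sum>i=1..k. a i) = t then 1 else 0)"
    by (simp add: fps_sum_nth eq_commute[of t])
  also have "\<dots> = of_nat (card {a \<in> ?A. (\<Sum>i=1..k. a i) = t})"
    using fin by (simp add: sum.If_cases Int_def)
  finally show ?thesis .
qed

text \<open>Used with \<open>m = n\<close>, this is the source of the subtraction in the theorem:
  vanishing products are counted through their complement.\<close>

lemma card_PiE_sum_split:
  "(n + 1) ^ k = card {a \<in> {1..k} \<rightarrow>\<^sub>E {..n}. m \<le> (\<Sum>i=1..k. a i)} +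
     (\<Sum>t<m. card {a \<in> {1..k} \<rightarrow>\<^sub>E {..n}. (\<Sum>i=1..k. a i) = t})"
proof -
  let ?A = "{1..k} \<rightarrow>\<^sub>E {..n}" and ?s = "\<lambda>a. \<Sum>i=1..k. a i"
  have fin: "finite ?A" by (simp add: finite_PiE)
  have "card ?A = card ({a \<in> ?A. m \<le> ?s a} \<union> {a \<in> ?A. ?s a < m})"
    by (rule arg_cong[of _ _ card]) auto
  also have "\<dots> = card {a \<in> ?A. m \<le> ?s a} + card {a \<in> ?A. ?s a < m}"
    using fin by (intro card_Un_disjoint) auto
  also have "{a \<in> ?A. ?s a < m} = (\<Union>t<m. {a \<in> ?A. ?s a = t})"
    by auto
  also have "card \<dots> = (\<Sum>t<m. card {a \<in> ?A. ?s a = t})"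
    using fin by (intro card_UN_disjoint) auto
  finally show ?thesis by (simp add: card_PiE)
qed

section \<open>Powers and products of principal ideals\<close>

lemma (in comm_monoid) finprod_nat_pow:
  assumes "x \<in> carrier G" "finite A"
  shows "(\<Otimes>i\<in>A. x [^] (f i :: nat)) = x [^] (\<Sum>i\<in>A. f i)"
  using assms(2) by induction (simp_all add: assms(1) nat_pow_mult)

text \<open>The products of an element of \<open>PIdl a\<close> with one of \<open>PIdl b\<close>
  already form an ideal, so passing to the generated ideal adds nothing.\<close>

lemma (in cring) ideal_prod_cgenideal:
  assumes "a \<in> carrier R" "b \<in> carrier R"
  shows "(PIdl a) \<cdot> (PIdl b) = PIdl (a \<otimes> b)"
proof -
  have "ideal (PIdl (a \<otimes> b)) R" using assms by (simp add: cgenideal_ideal)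
  then have "Idl (PIdl (a \<otimes> b)) = PIdl (a \<otimes> b)"
    by (intro subset_antisym genideal_minimal genideal_self subsetI) (auto dest: ideal.Icarr)
  then show ?thesis
    using assms by (simp add: ideal_prod_eq_genideal cgenideal_ideal cgenideal_prod)
qed

lemma (in cring) cgenideal_nat_pow:
  assumes "a \<in> carrier R"
  shows "(PIdl a) [^]\<^bsub>ideals_set R\<^esub> (i::nat) = PIdl (a [^] i)"
proof (induction i)
  case 0
  have "x \<in> PIdl \<one>" if "x \<in> carrier R" for x
    using that r_one[of x] by (force simp: cgenideal_def)
  then show ?case by (auto simp: ideals_set_def cgenideal_def)
next
  case (Suc i)
  then show ?case using assms by (simp add: ideals_set_def ideal_prod_cgenideal)
qed

section \<open>Units and principal ideals in a finite chain ring\<close>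

context finite_chain_ring
begin

abbreviation Mpow :: "nat \<Rightarrow> 'a set" where
  "Mpow i \<equiv> M [^]\<^bsub>ideals_set R\<^esub> i"

sublocale maximalideal M R
  using unique_maximal by blast

sublocale ideals: comm_monoid "ideals_set R"
  by (rule ideals_set_is_comm_monoid)

lemma carrier_ideals_set [simp]: "carrier (ideals_set R) = {J. ideal J R}"
  by (simp add: ideals_set_def)

lemma finite_ideals: "finite {J. ideal J R}"
  by (rule finite_subset[of _ "Pow (carrier R)"])
    (auto simp: finite_carrier dest: ideal.Icarr)

text \<open>By linearity \<open>PIdl u\<close>, not being inside \<open>M\<close>, contains
  \<open>M\<close>; maximality then makes it the whole ring, which contains
  \<open>\<one>\<close>.\<close>

lemma not_in_M_Units:
  assumes "u \<in> carrier R" "u \<notin> M"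
  shows "u \<in> Units R"
proof -
  have id: "ideal (PIdl u) R" and u: "u \<in> PIdl u"
    using assms by (simp_all add: cgenideal_ideal cgenideal_self)
  have "M \<subseteq> PIdl u"
    using ideals_linear[OF id is_ideal] u assms by blast
  then have "PIdl u = carrier R"
    using I_maximal[OF id] id u assms by (auto dest: ideal.Icarr)
  then have "\<one> \<in> PIdl u" by simp
  then obtain x where "x \<in> carrier R" "\<one> = x \<otimes> u"
    by (auto simp: cgenideal_def)
  then show ?thesis
    using assms by (auto simp: Units_def m_comm intro!: bexI[of _ x])
qed

lemma one_notin_M: "\<one> \<notin> M"
  using I_notcarr one_imp_carrier by auto

text \<open>Among the finitely many ideals \<open>PIdl a\<close> with \<open>a\<close> in
  \<open>I\<close> there is a maximal one; by linearity it contains all the others, hence all of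
  \<open>I\<close>.\<close>

lemma ideal_principal:
  assumes "ideal I R"
  obtains a where "a \<in> carrier R" "I = PIdl a"
proof -
  interpret I: ideal I R by fact
  let ?F = "(\<lambda>a. PIdl a) ` I"
  have "finite ?F"
    using I.a_subset finite_carrier finite_subset by blast
  moreover have "?F \<noteq> {}"
    using I.zero_closed by blast
  ultimately obtain J where J: "J \<in> ?F" "\<And>K. K \<in> ?F \<Longrightarrow> J \<subseteq> K \<Longrightarrow> K = J"
    using finite_has_maximal[of ?F] by metis
  then obtain a where a: "a \<in> I" "J = PIdl a" by auto
  have "I \<subseteq> PIdl a"
  proof
    fix b assume b: "b \<in> I"
    then have "PIdl b \<subseteq> J"
      using ideals_linear[of "PIdl b" J] J(2)[of "PIdl b"] a I.Icarr
      by (auto simp: cgenideal_ideal)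
    then show "b \<in> PIdl a"
      using cgenideal_self[of b] b a I.Icarr by auto
  qed
  then show ?thesis
    using that[of a] a cgenideal_minimal[OF assms a(1)] I.Icarr by auto
qed

section \<open>The descending chain of powers of \<open>M\<close>\<close>

lemma Mpow_0: "Mpow 0 = carrier R"
  by (simp add: ideals_set_def)

lemma ideal_Mpow: "ideal (Mpow i) R"
  using ideals.nat_pow_closed[of M i] is_ideal by simp

lemma Mpow_antimono:
  assumes "i \<le> j"
  shows "Mpow j \<subseteq> Mpow i"
proof -
  have "Mpow (Suc i) \<subseteq> Mpow i" for i
    using ideal_prod_inter[OF ideal_Mpow is_ideal, of i] by (simp add: ideals_set_def)
  then show ?thesis
    using assms by (rule lift_Suc_antimono_le)
qed

text \<open>Nakayama's argument for \<open>M = PIdl p\<close>: stability gives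
  \<open>p [^] i = r \<otimes> p [^] Suc i\<close>, so \<open>\<one> \<ominus> r \<otimes> p\<close>
  annihilates \<open>p [^] i\<close>, and this factor is a unit because it lies outside
  \<open>M\<close>.\<close>

lemma Mpow_eq_zero_if_stable:
  assumes "Mpow i = Mpow (Suc i)"
  shows "Mpow i = {\<zero>}"
proof -
  obtain p where p: "p \<in> carrier R" "M = PIdl p"
    using ideal_principal[OF is_ideal] .
  note pw = cgenideal_nat_pow[OF p(1), folded p(2)]
  have q: "p [^] i \<in> carrier R" using p(1) by simp
  have "p [^] i \<in> PIdl (p [^] Suc i)"
    using cgenideal_self[OF q] assms pw by metis
  then obtain r where r: "r \<in> carrier R" "p [^] i = r \<otimes> (p [^] i \<otimes> p)"
    by (auto simp: cgenideal_def)
  define u where "u = \<one> \<ominus> r \<otimes> p"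
  have u: "u \<in> carrier R" using r(1) p by (simp add: u_def)
  have rp: "r \<otimes> p \<in> M"
    using I_l_closed[OF _ r(1), of p] cgenideal_self[OF p(1)] p(2) by blast
  have "u \<notin> M"
  proof
    assume "u \<in> M"
    then have "u \<oplus> r \<otimes> p \<in> M" using rp by (rule a_closed)
    moreover have "u \<oplus> r \<otimes> p = \<one>"
      unfolding u_def using r(1) p(1) by algebra
    ultimately show False using one_notin_M by simp
  qed
  then have U: "u \<in> Units R" using not_in_M_Units u by blast
  have "u \<otimes> p [^] i = p [^] i \<ominus> r \<otimes> (p [^] i \<otimes> p)"
    unfolding u_def using r(1) p(1) q by algebra
  also have "\<dots> = \<zero>" using r(2) q r_right_minus_eq by metis
  finally have "u \<otimes> p [^] i = u \<otimes> \<zero>" using u by simp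
  then have "p [^] i = \<zero>" using U q Units_l_cancel by blast
  then show ?thesis
    unfolding pw[of i] by (simp add: cgenideal_eq_genideal genideal_zero)
qed

lemma Mpow_eq_zero_if_repeated:
  assumes "i < j" "Mpow i = Mpow j"
  shows "Mpow i = {\<zero>}"
proof -
  have "Mpow (Suc i) \<subseteq> Mpow i" "Mpow j \<subseteq> Mpow (Suc i)"
    using assms(1) by (intro Mpow_antimono; linarith)+
  then have "Mpow i = Mpow (Suc i)"
    using assms(2) by blast
  then show ?thesis by (rule Mpow_eq_zero_if_stable)
qed

text \<open>With only finitely many ideals two powers of \<open>M\<close> must coincide. This makes
  the \<open>LEAST\<close> in \<open>loewy_length\<close> an attained minimum.\<close>

lemma Mpow_nilpotent: "\<exists>i>0. Mpow i = {\<zero>}"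
proof -
  have "\<not> inj Mpow"
  proof
    assume inj: "inj Mpow"
    have "range Mpow \<subseteq> {J. ideal J R}"
      using ideal_Mpow by blast
    then have "finite (range Mpow)"
      using finite_ideals finite_subset by blast
    then show False
      using inj finite_imageD by blast
  qed
  then obtain i j where "Mpow i = Mpow j" "i < j"
    unfolding inj_def by (metis linorder_neqE_nat)
  then have "Mpow i = {\<zero>}" "Mpow j = {\<zero>}"
    using Mpow_eq_zero_if_repeated by blast+
  then show ?thesis
    using \<open>i < j\<close> by (intro exI[of _ j]) simp
qed

section \<open>The Loewy length and the classification of ideals\<close>

abbreviation loewy :: nat where
  "loewy \<equiv> loewy_length R M"

lemma loewy_pos: "loewy > 0" and Mpow_loewy: "Mpow loewy = {\<zero>}"
  using LeastI_ex[OF Mpow_nilpotent] by (simp_all add: loewy_length_def)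

lemma Mpow_eq_zero_iff: "Mpow i = {\<zero>} \<longleftrightarrow> loewy \<le> i"
proof
  assume i: "Mpow i = {\<zero>}"
  \<comment> \<open>\<open>loewy_length\<close> minimises over positive exponents only, so exponent
    0 is excluded separately: there the power is the whole ring, which is non-zero.\<close>
  have "i \<noteq> 0"
    using i one_not_zero one_closed Mpow_0 by (metis singletonD)
  then show "loewy \<le> i"
    using i by (simp add: loewy_length_def Least_le)
next
  assume "loewy \<le> i"
  then have "Mpow i \<subseteq> {\<zero>}"
    using Mpow_antimono[of loewy i] Mpow_loewy by simp
  then show "Mpow i = {\<zero>}"
    using additive_subgroup.zero_closed[OF ideal.axioms(1)[OF ideal_Mpow]] by blast
qed

lemma inj_on_Mpow: "inj_on Mpow {..loewy}"
proof (rule linorder_inj_onI)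
  fix i j assume ij: "i < j" "i \<in> {..loewy}" "j \<in> {..loewy}"
  show "Mpow i \<noteq> Mpow j"
  proof
    assume "Mpow i = Mpow j"
    with ij(1) have "Mpow i = {\<zero>}" by (rule Mpow_eq_zero_if_repeated)
    then show False using ij by (simp add: Mpow_eq_zero_iff)
  qed
qed auto

text \<open>For non-zero \<open>I\<close>, let \<open>i\<close> be the exponent where
  \<open>I\<close> lies in \<open>Mpow i\<close> but not in \<open>Mpow (Suc i)\<close>. An element
  of \<open>I\<close> outside \<open>Mpow (Suc i)\<close> is \<open>u \<otimes> p [^] i\<close> with
  \<open>u\<close> a unit, so \<open>I\<close> contains the generator \<open>p [^] i\<close> of
  \<open>Mpow i\<close>.\<close>

lemma ideal_eq_Mpow:
  assumes "ideal I R"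
  shows "\<exists>i\<le>loewy. I = Mpow i"
proof (cases "I \<subseteq> Mpow loewy")
  case True
  then show ?thesis
    using Mpow_loewy additive_subgroup.zero_closed[OF ideal.axioms(1)[OF assms]]
    by (intro exI[of _ loewy]) auto
next
  case False
  interpret I: ideal I R by fact
  obtain p where p: "p \<in> carrier R" "M = PIdl p"
    using ideal_principal[OF is_ideal] .
  note pw = cgenideal_nat_pow[OF p(1), folded p(2)]
  have "I \<subseteq> Mpow 0"
    using I.a_subset Mpow_0 by blast
  then obtain i where i: "i < loewy" "I \<subseteq> Mpow i" "\<not> I \<subseteq> Mpow (Suc i)"
    using False ex_least_nat_less[of "\<lambda>i. \<not> I \<subseteq> Mpow i" loewy] by blast
  then obtain x where x: "x \<in> I" "x \<in> Mpow i" "x \<notin> Mpow (Suc i)" by auto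
  then obtain u where u: "u \<in> carrier R" "x = u \<otimes> p [^] i"
    using pw[of i] by (auto simp: cgenideal_def)
  have q: "p [^] i \<in> carrier R" using p(1) by simp
  have "u \<notin> M"
  proof
    assume "u \<in> M"
    then have "u \<in> PIdl p" using p(2) by blast
    then obtain v where v: "v \<in> carrier R" "u = v \<otimes> p"
      by (auto simp: cgenideal_def)
    then have "x = v \<otimes> p [^] Suc i"
      using u(2) p(1) q by (simp add: m_ac)
    with v(1) have "x \<in> PIdl (p [^] Suc i)"
      unfolding cgenideal_def by blast
    then show False using x(3) pw[of "Suc i"] by blast
  qed
  then have U: "u \<in> Units R" using not_in_M_Units u by blast
  then have "inv u \<otimes> x = p [^] i"
    unfolding u(2) using u(1) q by (simp add: m_assoc[symmetric])
  moreover have "inv u \<otimes> x \<in> I" using x(1) U by (simp add: I.I_l_closed)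
  ultimately have "Mpow i \<subseteq> I"
    unfolding pw[of i] using cgenideal_minimal[OF assms] by simp
  then show ?thesis using i(1,2) by (intro exI[of _ i]) auto
qed

lemma bij_betw_Mpow: "bij_betw Mpow {..loewy} {J. ideal J R}"
  using inj_on_Mpow ideal_eq_Mpow ideal_Mpow by (auto simp: bij_betw_def)

lemma card_ideals: "card {J. ideal J R} = loewy + 1"
  using bij_betw_same_card[OF bij_betw_Mpow] by simp

section \<open>Counting tuples of ideals with zero product\<close>

lemma finprod_Mpow: "(\<Otimes>\<^bsub>ideals_set R\<^esub> i\<in>{1..k::nat}. Mpow (a i)) = Mpow (\<Sum>i=1..k. a i)"
  using is_ideal by (intro ideals.finprod_nat_pow) auto

lemma card_zero_product_tuples:
  "card (zero_product_tuples R k) =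
     card {a \<in> {1..k} \<rightarrow>\<^sub>E {..loewy}. loewy \<le> (\<Sum>i=1..k. a i)}" (is "_ = card ?A")
proof -
  \<comment> \<open>\<open>?f\<close> turns exponent tuples into tuples of ideals; restricting to
    \<open>{1..k}\<close> makes the image extensional, as membership in
    \<open>\<rightarrow>\<^sub>E\<close> demands.\<close>
  let ?f = "\<lambda>a. \<lambda>i\<in>{1..k}. Mpow (a i)"
  have prod_f: "(\<Otimes>\<^bsub>ideals_set R\<^esub> i\<in>{1..k}. ?f a i) = Mpow (\<Sum>i=1..k. a i)" for a
    unfolding finprod_Mpow[symmetric]
    by (rule ideals.finprod_cong') (auto simp: ideal_Mpow)
  have "inj_on ?f ?A"
  proof (rule inj_onI)
    fix a b assume a: "a \<in> ?A" and b: "b \<in> ?A" and eq: "?f a = ?f b"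
    show "a = b"
    proof (rule PiE_ext[of _ "{1..k}" "\<lambda>_. {..loewy}"])
      fix i assume i: "i \<in> {1..k}"
      then have "Mpow (a i) = Mpow (b i)" using fun_cong[OF eq, of i] by simp
      then show "a i = b i"
        using inj_onD[OF inj_on_Mpow] a b i by (auto simp: PiE_iff)
    qed (use a b in auto)
  qed
  moreover have "?f ` ?A = zero_product_tuples R k"
  proof
    show "?f ` ?A \<subseteq> zero_product_tuples R k"
    proof (rule image_subsetI)
      fix a assume "a \<in> ?A"
      then have "Mpow (\<Sum>i=1..k. a i) = {\<zero>}"
        by (simp only: Mpow_eq_zero_iff mem_Collect_eq)
      moreover have "?f a \<in> {1..k} \<rightarrow>\<^sub>E {J. ideal J R}"
        by (auto simp: ideal_Mpow)
      ultimately show "?f a \<in> zero_product_tuples R k"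
        unfolding zero_product_tuples_def mem_Collect_eq prod_f by blast
    qed
    show "zero_product_tuples R k \<subseteq> ?f ` ?A"
    proof
      fix I assume "I \<in> zero_product_tuples R k"
      then have I: "I \<in> {1..k} \<rightarrow>\<^sub>E {J. ideal J R}"
          "(\<Otimes>\<^bsub>ideals_set R\<^esub> i\<in>{1..k}. I i) = {\<zero>}"
        by (auto simp: zero_product_tuples_def)
      then have "\<forall>i\<in>{1..k}. \<exists>j\<le>loewy. I i = Mpow j"
        using ideal_eq_Mpow by (auto simp: PiE_iff)
      then obtain g where g: "\<And>i. i \<in> {1..k} \<Longrightarrow> g i \<le> loewy \<and> I i = Mpow (g i)"
        by metis
      define a where "a = restrict g {1..k}"
      have a: "a \<in> {1..k} \<rightarrow>\<^sub>E {..loewy}"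
        using g by (auto simp: a_def)
      have fa: "I = ?f a"
        using I(1) g by (intro extensionalityI[of _ "{1..k}"]) (auto simp: a_def PiE_iff)
      then have "Mpow (\<Sum>i=1..k. a i) = {\<zero>}"
        using I(2) prod_f by metis
      then show "I \<in> ?f ` ?A"
        unfolding Mpow_eq_zero_iff using a fa by blast
    qed
  qed
  ultimately show ?thesis
    by (rule bij_betw_same_card[OF bij_betw_imageI, symmetric])
qed

text \<open>The subtracted sum is the proportion of tuples with non-zero product. The separate
  conventions for \<open>k = 0\<close> and \<open>k = 1\<close> are checked to agree with this
  formula.\<close>

lemma ideal_zero_prob_eq:
  "ideal_zero_prob R k = 1 - (\<Sum>t<loewy. fps_nth (fps_nth (chain_kernel loewy) k) t)"
proof -
  let ?n = loewy
  define S where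
    "S = (\<lambda>t. card {a \<in> {1..k} \<rightarrow>\<^sub>E {..?n}. (\<Sum>i=1..k. a i) = t})"
  have "fps_nth (fps_nth (chain_kernel ?n) k) t = S t / (?n + 1) ^ k" for t
    unfolding chain_kernel_nth power_mult_distrib fps_const_power
    by (simp add: fps_nth_geometric_power S_def power_one_over add.commute)
  then have kernel: "(\<Sum>t<?n. fps_nth (fps_nth (chain_kernel ?n) k) t) =
      real (\<Sum>t<?n. S t) / real (?n + 1) ^ k"
    by (simp add: sum_divide_distrib)
  have "(?n + 1) ^ k = card (zero_product_tuples R k) + (\<Sum>t<?n. S t)"
    unfolding card_zero_product_tuples S_def by (rule card_PiE_sum_split)
  then have "real (?n + 1) ^ k = real (card (zero_product_tuples R k)) + real (\<Sum>t<?n. S t)"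
    by (metis of_nat_add of_nat_power)
  moreover have "1 - b / N = a / N" if "N = a + b" "N > 0" for a b N :: real
    using that by (simp add: field_simps)
  moreover have "real (?n + 1) ^ k > 0" by simp
  ultimately have main: "1 - (\<Sum>t<?n. fps_nth (fps_nth (chain_kernel ?n) k) t) =
      real (card (zero_product_tuples R k)) / real (card {J. ideal J R}) ^ k"
    unfolding kernel card_ideals by blast
  consider "k = 0" | "k = 1" | "k \<ge> 2" by linarith
  then show ?thesis
  proof cases
    case 1
    \<comment> \<open>The empty tuple has exponent sum 0, which is below \<open>loewy\<close>, so
      the convention 0 is also the true proportion.\<close>
    then have "card (zero_product_tuples R k) = 0"
      using loewy_pos by (simp add: card_zero_product_tuples)
    then show ?thesis using main 1 by (simp add: ideal_zero_prob_def)
  next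
    case 2
    \<comment> \<open>For \<open>k = 1\<close> each of the \<open>loewy\<close> coefficients is
      \<open>1 / (loewy + 1)\<close>, leaving exactly the conventional value.\<close>
    have "(\<Sum>t<?n. fps_nth (fps_nth (chain_kernel ?n) k) t) = (\<Sum>t<?n. 1 / real (?n + 1))"
      using 2 by (intro sum.cong) (auto simp: chain_kernel_nth fps_sum_nth fps_X_power_nth)
    then show ?thesis
      using 2 by (simp add: ideal_zero_prob_def card_ideals field_simps)
  next
    case 3
    then show ?thesis using main by (simp add: ideal_zero_prob_def)
  qed
qed

end

theorem corollary6p2:
  fixes R (structure) and M :: "'a set" and n :: nat
  assumes "finite_chain_ring R M"
    and "loewy_length R M = n"
  shows "ideal_zero_gf R =
    1 / (1 - fps_X) - (\<Sum>t = 0..<n. coeff_y t (chain_kernel n))"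
proof -
  interpret finite_chain_ring R M by fact
  \<comment> \<open>This series supplies the constant 1 in each coefficient, so comparing
    coefficients of \<open>x\<close> leaves \<open>ideal_zero_prob_eq\<close>.\<close>
  have "1 / (1 - fps_X) = (Abs_fps (\<lambda>_. 1) :: real fps)"
    by (simp add: fps_divide_unit flip: fps_inverse_gp')
  then show ?thesis
    using assms(2) ideal_zero_prob_eq
    by (intro fps_ext) (simp add: ideal_zero_gf_def coeff_y_def fps_sum_nth atLeast0LessThan)
qed

end
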